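(* Let $k\in\mathbb{N}$, let $\phi,\psi,a,b,\eta,\xi>0$ be real numbers and let $P,Q,R,S\in\mathscr{M}_k$. Then (i) $$\mathfrak{BL}_{(\phi,\psi)}^{(R,S,\eta,\xi)}(a,b;P,Q)=2a\int_{0}^{\pi/2}\left(\frac{b}{a}\right)^{\sin^{2}\theta}(\sin\theta)^{2P-I}(\cos\theta)^{2Q-I}\,\mathcal{E}_{(\phi,\psi)}(-R\csc^{2\eta}\theta)\,\mathcal{E}_{(\phi,\psi)}(-S\sec^{2\xi}\theta)\, d\theta;$$ (ii) $$\mathfrak{BL}_{(\phi,\psi)}^{(R,S,\eta,\xi)}(a,b;P,Q)=\int_{0}^{\infty}\frac{t^{P-I}}{(1+t)^{P+Q}}\,a^{\frac{1}{1+t}}b^{\frac{t}{1+t}}\,\mathcal{E}_{(\phi,\psi)}\left(-R(1+t^{-1})^{\eta}\right)\mathcal{E}_{(\phi,\psi)}\left(-S(1+t)^{\xi}\right) dt;$$ (iii) $$\mathfrak{BL}_{(\phi,\psi)}^{(R,S,\eta,\xi)}(a,b;P,Q)=\frac{2^{I}\sqrt{ab}}{2^{P+Q}}\int_{-1}^{1}(1+t)^{P-I}(1-t)^{Q-I}\left(\frac{b}{a}\right)^{\frac{t}{2}}\mathcal{E}_{(\phi,\psi)}\left(-R\left(\tfrac{1+t}{2}\right)^{-\eta}\right)\mathcal{E}_{(\phi,\psi)}\left(-S\left(\tfrac{1-t}{2}\right)^{-\xi}\right) dt.$$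
   Context: $\mathscr{M}_k$ is the set of $k\times k$ complex Hermitian matrices that are positive stable (all eigenvalues have positive real part). $I$ is the $k\times k$ identity matrix. For $x>0$ and a square matrix $A$, $x^{A}=\exp(A\ln x)$; a quotient $\frac{X}{Y}$ of matrices means $XY^{-1}$. The two-parameter Mittag-Leffler matrix function is $\mathcal{E}_{(\phi,\psi)}(A)=\sum_{n=0}^{\infty}\frac{A^n}{\Gamma(\phi n+\psi)}$ for $\phi,\psi>0$. For real $\phi,\psi,\eta,\xi,a,b>0$ and $P,Q,R,S\in\mathscr{M}_k$ the generalized beta-logarithmic matrix function is $$\mathfrak{BL}_{(\phi,\psi)}^{(R,S,\eta,\xi)}(a,b;P,Q)=\int_{0}^{1}a^{1-x}b^{x}x^{P-I}(1-x)^{Q-I}\mathcal{E}_{(\phi,\psi)}\left(-\frac{R}{x^{\eta}}\right)\mathcal{E}_{(\phi,\psi)}\left(-\frac{S}{(1-x)^{\xi}}\right)dx,$$ with matrix products taken in the written order.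
   Formalization: Parts (ii) and (iii) are proved under the added assumption PQ = QP; without it they fail, e.g. for P = diag(1,3), Q = [[2,1],[1,2]], R = S = I and all parameters 1. Part (i) is proved without this assumption. *)

theory Defs
  imports "HOL-Analysis.Analysis"
begin

(* A k x k complex matrix is an element of complex^'k^'k, where k = CARD('k).  The type class
   operations * and ^ on this type act componentwise, so powers, exp and series are built from the
   matrix product ** instead.  Infinite sums are limits in the Euclidean norm of complex^'k^'k, that
   is, entrywise limits. *)

primrec matrix_power :: "complex^'k^'k \<Rightarrow> nat \<Rightarrow> complex^'k^'k" where
  "matrix_power A 0 = mat 1"
| "matrix_power A (Suc n) = A ** matrix_power A n"

definition matrix_exp :: "complex^'k^'k \<Rightarrow> complex^'k^'k" where
  "matrix_exp A = (\<Sum>n. (1 / fact n) *\<^sub>R matrix_power A n)"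

(* x raised to the matrix power A; meant for x > 0 only. *)
definition matrix_powr :: "real \<Rightarrow> complex^'k^'k \<Rightarrow> complex^'k^'k" where
  "matrix_powr x A = matrix_exp (ln x *\<^sub>R A)"

definition matrix_divide :: "complex^'k^'k \<Rightarrow> complex^'k^'k \<Rightarrow> complex^'k^'k" where
  "matrix_divide X Y = X ** matrix_inv Y"

definition hermitian :: "complex^'k^'k \<Rightarrow> bool" where
  "hermitian A \<longleftrightarrow> map_matrix cnj (transpose A) = A"

definition is_eigenvalue :: "complex^'k^'k \<Rightarrow> complex \<Rightarrow> bool" where
  "is_eigenvalue A c \<longleftrightarrow> (\<exists>v. v \<noteq> 0 \<and> A *v v = c *s v)"

definition positive_stable :: "complex^'k^'k \<Rightarrow> bool" where
  "positive_stable A \<longleftrightarrow> (\<forall>c. is_eigenvalue A c \<longrightarrow> Re c > 0)"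

definition herm_pos_stable :: "(complex^'k^'k) set" where
  "herm_pos_stable = {A. hermitian A \<and> positive_stable A}"

definition mittag_leffler :: "real \<Rightarrow> real \<Rightarrow> complex^'k^'k \<Rightarrow> complex^'k^'k" where
  "mittag_leffler \<phi> \<psi> A = (\<Sum>n. (1 / Gamma (\<phi> * real n + \<psi>)) *\<^sub>R matrix_power A n)"

definition beta_log_integrand ::
  "real \<Rightarrow> real \<Rightarrow> complex^'k^'k \<Rightarrow> complex^'k^'k \<Rightarrow> real \<Rightarrow> real \<Rightarrow>
   real \<Rightarrow> real \<Rightarrow> complex^'k^'k \<Rightarrow> complex^'k^'k \<Rightarrow> real \<Rightarrow> complex^'k^'k" where
  "beta_log_integrand \<phi> \<psi> R S \<eta> \<xi> a b P Q x =
     (a powr (1 - x) * b powr x) *\<^sub>R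
       (matrix_powr x (P - mat 1) ** matrix_powr (1 - x) (Q - mat 1)
        ** mittag_leffler \<phi> \<psi> (- (R /\<^sub>R (x powr \<eta>)))
        ** mittag_leffler \<phi> \<psi> (- (S /\<^sub>R ((1 - x) powr \<xi>))))"

(* The Henstock-Kurzweil integral agrees with the Lebesgue integral of absolutely integrable
   functions and also covers conditionally convergent improper integrals.  It is 0 when the
   integral does not exist, which can happen here for \<phi> > 2. *)
definition beta_log ::
  "real \<Rightarrow> real \<Rightarrow> complex^'k^'k \<Rightarrow> complex^'k^'k \<Rightarrow> real \<Rightarrow> real \<Rightarrow>
   real \<Rightarrow> real \<Rightarrow> complex^'k^'k \<Rightarrow> complex^'k^'k \<Rightarrow> complex^'k^'k" where
  "beta_log \<phi> \<psi> R S \<eta> \<xi> a b P Q =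
     integral {0<..<1} (beta_log_integrand \<phi> \<psi> R S \<eta> \<xi> a b P Q)"

end

theory Submission
  imports Defs "HOL-Real_Asymp.Real_Asymp"
begin

text \<open>
  Each formula is a change of variables, \<open>x = sin\<^sup>2 \<theta>\<close>, \<open>x = t / (1 + t)\<close> and \<open>x = (1 + t) / 2\<close>.
  The integral may exist only conditionally, or not at all, so substitution rules for absolutely
  integrable functions do not suffice.  Instead, the integrand is continuous on the open interval
  and so has a primitive \<open>F\<close> there; the Henstock-Kurzweil integral exists if and only if \<open>F\<close> has
  limits at both endpoints, and is then their difference.  A reparametrisation of the interval
  preserves this criterion.  Continuity of the integrand comes from locally uniform
  convergence of the series, for which \<open>\<Gamma>(\<phi>n + \<psi>)\<close> must outgrow every \<open>K\<^sup>n\<close>.  The remaining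
  matrix identities only need that the exponential is multiplicative on commuting matrices.
\<close>

section \<open>Substitution in improper Henstock-Kurzweil integrals\<close>

text \<open>Forward, the indefinite integral of \<open>f\<close> is continuous on the closed
  interval and differs from \<open>F\<close> by a constant inside, so \<open>F\<close> inherits its
  one-sided limits. Backward, \<open>F\<close> extended by its two limits is continuous on the
  closed interval, and the fundamental theorem asks for a derivative only in the interior.\<close>

lemma has_integral_Ioo_iff_primitive:
  fixes f F :: "real \<Rightarrow> 'a::banach"
  assumes "a < b"
    and deriv: "\<And>x. a < x \<Longrightarrow> x < b \<Longrightarrow> (F has_vector_derivative f x) (at x)"
  shows "(f has_integral I) {a<..<b} \<longleftrightarrow>
    (\<exists>l r. (F \<longlongrightarrow> l) (at_right a) \<and> (F \<longlongrightarrow> r) (at_left b) \<and> I = r - l)"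
proof
  assume "(f has_integral I) {a<..<b}"
  then have I: "(f has_integral I) {a..b}"
    by (simp add: has_integral_Icc_iff_Ioo)
  then have int: "f integrable_on {a..b}"
    by blast
  define G where "G x = integral {a..x} f" for x
  have G: "continuous_on {a..b} G"
    unfolding G_def by (rule indefinite_integral_continuous_1[OF int])
  \<comment> \<open>Both differences equal the integral of \<open>f\<close> over the compact
    interval from \<open>x\<close> to \<open>y\<close>; hence \<open>F - G\<close> is constant on
    the open interval.\<close>
  have diff: "F y - F x = G y - G x" if "a < x" "x \<le> y" "y < b" for x y
  proof -
    have "(f has_integral (F y - F x)) {x..y}"
      using that deriv
      by (intro fundamental_theorem_of_calculus) (auto intro: has_vector_derivative_at_within)
    moreover have "integral {a..x} f + integral {x..y} f = integral {a..y} f"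
      using that int by (intro Henstock_Kurzweil_Integration.integral_combine)
        (auto intro: integrable_on_subinterval)
    ultimately show ?thesis
      by (simp add: G_def integral_unique algebra_simps)
  qed
  obtain m where m: "a < m" "m < b"
    using \<open>a < b\<close> dense by blast
  have FG: "G x + (F m - G m) = F x" if "a < x" "x < b" for x
    using diff[of x m] diff[of m x] that m by (cases "x \<le> m") (auto simp: algebra_simps)
  have "(G \<longlongrightarrow> G a) (at_right a)" "(G \<longlongrightarrow> G b) (at_left b)"
    using G \<open>a < b\<close> by (auto simp: continuous_on_def at_within_Icc_at_right at_within_Icc_at_left
        dest: bspec[where x = a] bspec[where x = b])
  then have lims: "((\<lambda>x. G x + (F m - G m)) \<longlongrightarrow> G a + (F m - G m)) (at_right a)"
    "((\<lambda>x. G x + (F m - G m)) \<longlongrightarrow> G b + (F m - G m)) (at_left b)"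
    by (auto intro!: tendsto_intros)
  have "(F \<longlongrightarrow> G a + (F m - G m)) (at_right a)"
    by (rule Lim_transform_eventually[OF lims(1)])
      (use FG \<open>a < b\<close> in \<open>auto simp: eventually_at_right_field\<close>)
  moreover have "(F \<longlongrightarrow> G b + (F m - G m)) (at_left b)"
    by (rule Lim_transform_eventually[OF lims(2)])
      (use FG \<open>a < b\<close> in \<open>auto simp: eventually_at_left_field\<close>)
  moreover have "I = (G b + (F m - G m)) - (G a + (F m - G m))"
    using I by (simp add: G_def integral_unique)
  ultimately show "\<exists>l r. (F \<longlongrightarrow> l) (at_right a) \<and> (F \<longlongrightarrow> r) (at_left b) \<and> I = r - l"
    by blast
next
  assume "\<exists>l r. (F \<longlongrightarrow> l) (at_right a) \<and> (F \<longlongrightarrow> r) (at_left b) \<and> I = r - l"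
  then obtain l r where l: "(F \<longlongrightarrow> l) (at_right a)" and r: "(F \<longlongrightarrow> r) (at_left b)"
    and I: "I = r - l"
    by blast
  define G where "G x = (if x \<le> a then l else if b \<le> x then r else F x)" for x
  have G_deriv: "(G has_vector_derivative f x) (at x)" if "a < x" "x < b" for x
    by (rule has_vector_derivative_transform_within_open[OF deriv[OF that], of "{a<..<b}"])
      (use that in \<open>auto simp: G_def\<close>)
  have "continuous_on {a..b} G"
  proof (rule continuous_on_IccI)
    have "eventually (\<lambda>x. F x = G x) (at_right a)" "eventually (\<lambda>x. F x = G x) (at_left b)"
      using \<open>a < b\<close> by (auto simp: G_def eventually_at_right_field eventually_at_left_field)
    then show "(G \<longlongrightarrow> G a) (at_right a)" "(G \<longlongrightarrow> G b) (at_left b)"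
      using Lim_transform_eventually[OF l] Lim_transform_eventually[OF r] \<open>a < b\<close>
      by (auto simp: G_def)
    show "G \<midarrow>x\<rightarrow> G x" if "a < x" "x < b" for x
      using has_vector_derivative_continuous[OF G_deriv[OF that]] by (simp add: continuous_at)
  qed fact
  then have "(f has_integral (G b - G a)) {a..b}"
    using \<open>a < b\<close> G_deriv by (intro fundamental_theorem_of_calculus_interior) auto
  then show "(f has_integral I) {a<..<b}"
    using \<open>a < b\<close> by (simp add: G_def I has_integral_Icc_iff_Ioo)
qed

text \<open>Integrability over an unbounded set means that the integrals of the zero extension
  \<open>h\<close> over \<open>{u..v}\<close> converge as the interval exhausts the line. Once
  \<open>u \<le> a < v\<close>, that integral is \<open>F v - l\<close> by the bounded case, so the
  convergence is exactly that of \<open>F\<close> at infinity.\<close>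

lemma has_integral_Ioi_iff_primitive:
  fixes f F :: "real \<Rightarrow> 'a::banach"
  assumes deriv: "\<And>x. a < x \<Longrightarrow> (F has_vector_derivative f x) (at x)"
  shows "(f has_integral I) {a<..} \<longleftrightarrow>
    (\<exists>l r. (F \<longlongrightarrow> l) (at_right a) \<and> (F \<longlongrightarrow> r) at_top \<and> I = r - l)"
proof -
  define h where "h x = (if x \<in> {a<..} then f x else 0)" for x
  have alt: "(f has_integral I) {a<..} \<longleftrightarrow> (\<forall>u v. h integrable_on {u..v}) \<and>
    (\<forall>e>0. \<exists>B>0. \<forall>u v. ball 0 B \<subseteq> {u..v} \<longrightarrow> norm (integral {u..v} h - I) < e)"
    unfolding h_def using has_integral_alt'[of f I "{a<..}"] by simp
  have h_iff: "(h has_integral J) {u..v} \<longleftrightarrow> (f has_integral J) {a<..<v}"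
    if "u \<le> a" for u v J
  proof -
    have "(h has_integral J) {u..v} \<longleftrightarrow> (h has_integral J) {u<..<v}"
      by (rule has_integral_Icc_iff_Ioo)
    also have "\<dots> \<longleftrightarrow> (f has_integral J) ({a<..} \<inter> {u<..<v})"
      unfolding h_def by (rule has_integral_restrict_Int)
    also have "{a<..} \<inter> {u<..<v} = {a<..<v}"
      using that by auto
    finally show ?thesis .
  qed
  have at_left: "(F \<longlongrightarrow> F v) (at_left v)" if "a < v" for v
    using has_vector_derivative_continuous[OF deriv[OF that]]
    by (auto simp: continuous_at intro: filterlim_at_split[THEN iffD1, THEN conjunct1])
  show ?thesis
  proof
    assume "(f has_integral I) {a<..}"
    note I = this[unfolded alt]
    obtain J where "(f has_integral J) {a<..<a+1}"
      using I h_iff[where u = a and v = "a + 1"] by (meson order_refl integrable_on_def)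
    then obtain l where l: "(F \<longlongrightarrow> l) (at_right a)"
      using has_integral_Ioo_iff_primitive[of a "a+1" F f] deriv by auto
    have hF: "integral {u..v} h = F v - l" if "u \<le> a" "a < v" for u v
      using h_iff[OF that(1), where J = "F v - l" and v = v] has_integral_Ioo_iff_primitive[of a v F f "F v - l"]
        l at_left that deriv by (auto intro!: integral_unique)
    have "(F \<longlongrightarrow> I + l) at_top"
    proof (rule tendstoI)
      fix e :: real assume "e > 0"
      then obtain B where "B > 0"
        and B: "\<And>u v. ball 0 B \<subseteq> {u..v} \<Longrightarrow> norm (integral {u..v} h - I) < e"
        using I by blast
      have "dist (F v) (I + l) < e" if "v \<ge> max B (a + 1)" for v
      proof -
        \<comment> \<open>The left end is at most \<open>-B\<close>, to cover the ball, and at most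
          \<open>a\<close>, so that \<open>hF\<close> evaluates the integral.\<close>
        have "ball 0 B \<subseteq> {min a (-B)..v}"
          using that by (auto simp: ball_eq_greaterThanLessThan)
        from B[OF this] show ?thesis
          using hF[of "min a (-B)" v] that by (simp add: dist_norm algebra_simps)
      qed
      then show "eventually (\<lambda>v. dist (F v) (I + l) < e) at_top"
        unfolding eventually_at_top_linorder by blast
    qed
    with l show "\<exists>l r. (F \<longlongrightarrow> l) (at_right a) \<and> (F \<longlongrightarrow> r) at_top \<and> I = r - l"
      by (metis add_diff_cancel_right')
  next
    assume "\<exists>l r. (F \<longlongrightarrow> l) (at_right a) \<and> (F \<longlongrightarrow> r) at_top \<and> I = r - l"
    then obtain l r where l: "(F \<longlongrightarrow> l) (at_right a)" and r: "(F \<longlongrightarrow> r) at_top"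
      and I: "I = r - l"
      by blast
    have h: "(h has_integral (F v - l)) {u..v}" if "u \<le> a" "a < v" for u v
      using h_iff[OF that(1), where J = "F v - l" and v = v] has_integral_Ioo_iff_primitive[of a v F f "F v - l"]
        l at_left that deriv by auto
    have "h integrable_on {u..v}" for u v
    proof -
      \<comment> \<open>An arbitrary interval is enlarged until it straddles \<open>a\<close>, where
        the integral is known, and then restricted again.\<close>
      have "h integrable_on {min u a..max v (a+1)}"
        using h[of "min u a" "max v (a+1)"] by (meson has_integral_integrable less_add_one
            max.strict_coboundedI2 min.cobounded2)
      then show ?thesis
        by (rule integrable_on_subinterval) auto
    qed
    moreover have "\<exists>B>0. \<forall>u v. ball 0 B \<subseteq> {u..v} \<longrightarrow> norm (integral {u..v} h - I) < e"
      if "e > 0" for e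
    proof -
      obtain N where N: "\<And>v. v \<ge> N \<Longrightarrow> dist (F v) r < e"
        using tendstoD[OF r \<open>e > 0\<close>] by (auto simp: eventually_at_top_linorder)
      \<comment> \<open>An interval containing this ball must begin left of \<open>a\<close> and end
        beyond both \<open>a\<close> and \<open>N\<close>. The ball is open, so the two test points
        below lie half a unit inside it.\<close>
      define B where "B = \<bar>N\<bar> + \<bar>a\<bar> + 1"
      have "norm (integral {u..v} h - I) < e" if "ball 0 B \<subseteq> {u..v}" for u v
      proof -
        have "B > 0" by (simp add: B_def)
        have "- \<bar>N\<bar> - \<bar>a\<bar> - 1/2 \<in> ball 0 B" "\<bar>N\<bar> + \<bar>a\<bar> + 1/2 \<in> ball 0 B"
          by (auto simp: B_def dist_real_def)
        with that have "- \<bar>N\<bar> - \<bar>a\<bar> - 1/2 \<in> {u..v}" "\<bar>N\<bar> + \<bar>a\<bar> + 1/2 \<in> {u..v}"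
          by blast+
        then have uv: "u \<le> a" "a < v" "v \<ge> N"
          unfolding atLeastAtMost_iff by linarith+
        then show ?thesis
          using integral_unique[OF h[OF uv(1,2)]] N[OF uv(3)] by (simp add: I dist_norm)
      qed
      moreover have "B > 0" by (simp add: B_def)
      ultimately show ?thesis by blast
    qed
    ultimately show "(f has_integral I) {a<..}"
      unfolding alt by blast
  qed
qed

text \<open>The direction from \<open>F \<circ> g\<close> back to \<open>F\<close> uses the right
  inverse \<open>h\<close>. It is what lets non-existence of a limit, and hence of an integral,
  survive the substitution.\<close>

lemma tendsto_compose_iff:
  assumes "filterlim g A B" "filterlim h B A" "eventually (\<lambda>x. g (h x) = x) A"
  shows "((\<lambda>t. F (g t)) \<longlongrightarrow> l) B \<longleftrightarrow> (F \<longlongrightarrow> l) A"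
proof
  assume "((\<lambda>t. F (g t)) \<longlongrightarrow> l) B"
  then have "((\<lambda>x. F (g (h x))) \<longlongrightarrow> l) A"
    using assms(2) by (rule filterlim_compose)
  then show "(F \<longlongrightarrow> l) A"
    by (rule Lim_transform_eventually) (use assms(3) in \<open>auto elim: eventually_mono\<close>)
qed (rule filterlim_compose[OF _ assms(1)])

lemma continuous_on_Ioo_primitive:
  fixes f :: "real \<Rightarrow> 'a::euclidean_space"
  assumes "a < b" "continuous_on {a<..<b} f"
  obtains F where "\<And>x. a < x \<Longrightarrow> x < b \<Longrightarrow> (F has_vector_derivative f x) (at x)"
  using einterval_antiderivative[of a b f] assms by (auto simp: continuous_on_eq_continuous_at)

lemma has_vector_derivative_compose:
  assumes "(g has_real_derivative g') (at t)" "(F has_vector_derivative f') (at (g t))"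
  shows "((\<lambda>t. F (g t)) has_vector_derivative g' *\<^sub>R f') (at t)"
  using vector_diff_chain_at[of g g' t F f'] assms
  by (simp add: o_def has_real_derivative_iff_has_vector_derivative)

text \<open>If \<open>F\<close> is a primitive of \<open>f\<close>, then \<open>F \<circ> g\<close>
  is one of the transformed integrand. Their endpoint limits exist simultaneously and agree, so the
  primitive criterion gives the same answer on both intervals.\<close>

lemma has_integral_substitution_Ioo_Ioo:
  fixes f :: "real \<Rightarrow> 'a::euclidean_space"
  assumes "a < b" "c < d" "continuous_on {a<..<b} f"
    and g: "\<And>t. c < t \<Longrightarrow> t < d \<Longrightarrow> a < g t \<and> g t < b"
    and g': "\<And>t. c < t \<Longrightarrow> t < d \<Longrightarrow> (g has_real_derivative g' t) (at t)"
    and gh: "\<And>x. a < x \<Longrightarrow> x < b \<Longrightarrow> g (h x) = x"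
    and lims: "filterlim g (at_right a) (at_right c)" "filterlim g (at_left b) (at_left d)"
      "filterlim h (at_right c) (at_right a)" "filterlim h (at_left d) (at_left b)"
  shows "((\<lambda>t. g' t *\<^sub>R f (g t)) has_integral I) {c<..<d} \<longleftrightarrow> (f has_integral I) {a<..<b}"
proof -
  obtain F where F: "\<And>x. a < x \<Longrightarrow> x < b \<Longrightarrow> (F has_vector_derivative f x) (at x)"
    using continuous_on_Ioo_primitive assms(1,3) by blast
  have Fg: "((\<lambda>t. F (g t)) has_vector_derivative g' t *\<^sub>R f (g t)) (at t)" if "c < t" "t < d" for t
    using g[OF that] g'[OF that] F by (intro has_vector_derivative_compose) auto
  have "eventually (\<lambda>x. g (h x) = x) (at_right a)" "eventually (\<lambda>x. g (h x) = x) (at_left b)"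
    using gh \<open>a < b\<close> by (auto simp: eventually_at_right_field eventually_at_left_field)
  note iffs = tendsto_compose_iff[OF lims(1,3) this(1)] tendsto_compose_iff[OF lims(2,4) this(2)]
  show ?thesis
    using has_integral_Ioo_iff_primitive[OF \<open>c < d\<close> Fg, of I]
      has_integral_Ioo_iff_primitive[OF \<open>a < b\<close> F, of I] by (simp add: iffs)
qed

lemma has_integral_substitution_Ioi_Ioo:
  fixes f :: "real \<Rightarrow> 'a::euclidean_space"
  assumes "a < b" "continuous_on {a<..<b} f"
    and g: "\<And>t. c < t \<Longrightarrow> a < g t \<and> g t < b"
    and g': "\<And>t. c < t \<Longrightarrow> (g has_real_derivative g' t) (at t)"
    and gh: "\<And>x. a < x \<Longrightarrow> x < b \<Longrightarrow> g (h x) = x"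
    and lims: "filterlim g (at_right a) (at_right c)" "filterlim g (at_left b) at_top"
      "filterlim h (at_right c) (at_right a)" "filterlim h at_top (at_left b)"
  shows "((\<lambda>t. g' t *\<^sub>R f (g t)) has_integral I) {c<..} \<longleftrightarrow> (f has_integral I) {a<..<b}"
proof -
  obtain F where F: "\<And>x. a < x \<Longrightarrow> x < b \<Longrightarrow> (F has_vector_derivative f x) (at x)"
    using continuous_on_Ioo_primitive assms(1,2) by blast
  have Fg: "((\<lambda>t. F (g t)) has_vector_derivative g' t *\<^sub>R f (g t)) (at t)" if "c < t" for t
    using g[OF that] g'[OF that] F by (intro has_vector_derivative_compose) auto
  have "eventually (\<lambda>x. g (h x) = x) (at_right a)" "eventually (\<lambda>x. g (h x) = x) (at_left b)"
    using gh \<open>a < b\<close> by (auto simp: eventually_at_right_field eventually_at_left_field)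
  note iffs = tendsto_compose_iff[OF lims(1,3) this(1)] tendsto_compose_iff[OF lims(2,4) this(2)]
  show ?thesis
    using has_integral_Ioi_iff_primitive[OF Fg, of c I]
      has_integral_Ioo_iff_primitive[OF \<open>a < b\<close> F, of I] by (simp add: iffs)
qed

text \<open>Since \<open>integral\<close> is defined from \<open>has_integral\<close> alone, the
  equality also covers the divergent case, where both sides take the default value 0.\<close>

lemma integral_eq_if_has_integral_iff:
  assumes "\<And>I. (f has_integral I) A \<longleftrightarrow> (g has_integral I) B"
  shows "(f integrable_on A \<longleftrightarrow> g integrable_on B) \<and> integral A f = integral B g"
  using assms unfolding integrable_on_def integral_def by simp

section \<open>Endpoint limits of the three changes of variables and of their inverses\<close>

lemma filterlim_sin_squared:
  "filterlim (\<lambda>x::real. (sin x)\<^sup>2) (at_right 0) (at_right 0)"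
  "filterlim (\<lambda>x::real. (sin x)\<^sup>2) (at_left 1) (at_left (pi/2))"
  "filterlim (\<lambda>x::real. arcsin (sqrt x)) (at_right 0) (at_right 0)"
  "filterlim (\<lambda>x::real. arcsin (sqrt x)) (at_left (pi/2)) (at_left 1)"
proof -
  show "filterlim (\<lambda>x::real. (sin x)\<^sup>2) (at_right 0) (at_right 0)"
  proof (rule tendsto_imp_filterlim_at_right)
    have "(sin x)\<^sup>2 > 0" if "0 < x" "x < pi" for x :: real
      using sin_gt_zero[OF that] by simp
    then show "eventually (\<lambda>x::real. (sin x)\<^sup>2 > 0) (at_right 0)"
      using eventually_at_right_real[OF pi_gt_zero] by (auto elim: eventually_mono)
  qed (auto intro!: tendsto_eq_intros)
  show "filterlim (\<lambda>x::real. (sin x)\<^sup>2) (at_left 1) (at_left (pi/2))"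
  proof (rule tendsto_imp_filterlim_at_left)
    have "(sin x)\<^sup>2 < 1" if "0 < x" "x < pi/2" for x :: real
      using cos_gt_zero[OF that] sin_cos_squared_add[of x] zero_less_power[of "cos x" 2] by linarith
    then show "eventually (\<lambda>x::real. (sin x)\<^sup>2 < 1) (at_left (pi/2))"
      using eventually_at_left_real[OF pi_half_gt_zero] by (auto elim: eventually_mono)
  qed (auto intro!: tendsto_eq_intros)
  \<comment> \<open>Continuity up to the endpoints gives the limits; the strict bounds below then
    show that they are approached from inside the interval.\<close>
  have "continuous_on {0..1} (\<lambda>x::real. arcsin (sqrt x))"
    by (intro continuous_intros) (auto intro: order_trans[of _ 0])
  then have lims: "((\<lambda>x::real. arcsin (sqrt x)) \<longlongrightarrow> 0) (at_right 0)"
    "((\<lambda>x::real. arcsin (sqrt x)) \<longlongrightarrow> pi/2) (at_left 1)"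
    by (force simp: continuous_on_def at_within_Icc_at_right at_within_Icc_at_left
        dest: bspec[where x = 0] bspec[where x = 1])+
  have bounds: "0 < arcsin (sqrt x)" "arcsin (sqrt x) < pi/2" if "0 < x" "x < 1" for x :: real
    using that arcsin_less_arcsin[of 0 "sqrt x"] arcsin_less_arcsin[of "sqrt x" 1]
      order_trans[of "-1" 0 "sqrt x"] by auto
  show "filterlim (\<lambda>x::real. arcsin (sqrt x)) (at_right 0) (at_right 0)"
    using lims bounds eventually_at_right_real[of 0 1]
    by (intro tendsto_imp_filterlim_at_right) (auto elim: eventually_mono)
  show "filterlim (\<lambda>x::real. arcsin (sqrt x)) (at_left (pi/2)) (at_left 1)"
    using lims bounds eventually_at_left_real[of 0 1]
    by (intro tendsto_imp_filterlim_at_left) (auto elim: eventually_mono)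
qed

lemma filterlim_divide_one_plus:
  "filterlim (\<lambda>t::real. t / (1+t)) (at_right 0) (at_right 0)"
  "filterlim (\<lambda>t::real. t / (1+t)) (at_left 1) at_top"
  "filterlim (\<lambda>x::real. x / (1-x)) (at_right 0) (at_right 0)"
  "filterlim (\<lambda>x::real. x / (1-x)) at_top (at_left 1)"
  by real_asymp+

lemma filterlim_half_one_plus:
  "filterlim (\<lambda>t::real. (1+t)/2) (at_right 0) (at_right (-1))"
  "filterlim (\<lambda>t::real. (1+t)/2) (at_left 1) (at_left 1)"
  "filterlim (\<lambda>x::real. 2*x-1) (at_right (-1)) (at_right 0)"
  "filterlim (\<lambda>x::real. 2*x-1) (at_left 1) (at_left 1)"
  by real_asymp+

section \<open>Matrix power series\<close>

lemma matrix_mult_scaleR_left: "(c *\<^sub>R A) ** B = c *\<^sub>R (A ** B)"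
  for A B :: "complex^'k^'k"
  by (simp add: matrix_matrix_mult_def vec_eq_iff scaleR_sum_right)

lemma matrix_mult_scaleR_right: "A ** (c *\<^sub>R B) = c *\<^sub>R (A ** B)"
  for A B :: "complex^'k^'k"
  by (simp add: matrix_matrix_mult_def vec_eq_iff scaleR_sum_right)

lemma matrix_add_rdistrib: "(A + B) ** C = A ** C + B ** C"
  for A B C :: "complex^'k^'k"
  by (simp add: matrix_matrix_mult_def vec_eq_iff distrib_right sum.distrib)

lemma bounded_bilinear_matrix_mult:
  "bounded_bilinear ((**) :: complex^'k^'k \<Rightarrow> complex^'k^'k \<Rightarrow> complex^'k^'k)"
  unfolding bilinear_conv_bounded_bilinear[symmetric] bilinear_def
  by (auto intro!: linearI simp: matrix_add_ldistrib matrix_add_rdistrib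
      matrix_mult_scaleR_left matrix_mult_scaleR_right)

interpretation matrix_mult: bounded_bilinear
  "(**) :: complex^'k^'k \<Rightarrow> complex^'k^'k \<Rightarrow> complex^'k^'k"
  by (rule bounded_bilinear_matrix_mult)

lemma matrix_power_scaleR: "matrix_power (c *\<^sub>R A) n = c ^ n *\<^sub>R matrix_power A n"
  by (induction n) (simp_all add: matrix_mult_scaleR_left matrix_mult_scaleR_right)

lemma matrix_power_mat_1: "matrix_power (mat 1) n = mat 1"
  by (induction n) simp_all

text \<open>The ratio is \<open>norm A\<close> times the bound of the bilinear product. The factor
  \<open>C\<close> is the norm of the identity, which in the Euclidean norm is in general larger
  than 1.\<close>

lemma norm_matrix_power_le:
  fixes A :: "complex^'k^'k"
  obtains C K where "C \<ge> 0" "K \<ge> 0" "\<And>n. norm (matrix_power A n) \<le> C * K ^ n"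
proof -
  obtain K where "K \<ge> 0"
    and K: "\<And>(A :: complex^'k^'k) (B :: complex^'k^'k). norm (A ** B) \<le> norm A * norm B * K"
    using matrix_mult.nonneg_bounded[where 'k = 'k] by blast
  have "norm (matrix_power A n) \<le> norm (mat 1 :: complex^'k^'k) * (norm A * K) ^ n" for n
  proof (induction n)
    case (Suc n)
    have "norm (matrix_power A (Suc n)) \<le> norm (matrix_power A n) * (norm A * K)"
      using K[of A "matrix_power A n"] by (simp add: mult_ac)
    also have "\<dots> \<le> norm (mat 1 :: complex^'k^'k) * (norm A * K) ^ n * (norm A * K)"
      using Suc \<open>K \<ge> 0\<close> by (intro mult_right_mono) auto
    finally show ?case by (simp add: mult_ac)
  qed simp
  then show ?thesis
    using that[of "norm (mat 1 :: complex^'k^'k)" "norm A * K"] \<open>K \<ge> 0\<close> by simp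
qed

lemma summable_norm_matrix_series:
  fixes A :: "complex^'k^'k"
  assumes "\<And>K. summable (\<lambda>n. \<bar>c n\<bar> * K ^ n)"
  shows "summable (\<lambda>n. norm (c n *\<^sub>R matrix_power A n))"
proof -
  obtain C K where CK: "\<And>n. norm (matrix_power A n) \<le> C * K ^ n"
    using norm_matrix_power_le by blast
  have "norm (c n *\<^sub>R matrix_power A n) \<le> C * (\<bar>c n\<bar> * K ^ n)" for n
    using mult_left_mono[OF CK[of n], of "\<bar>c n\<bar>"] by (simp add: mult_ac)
  then show ?thesis
    by (intro summable_comparison_test'[OF summable_mult[OF assms[of K]], of 0 _ C]) simp
qed

text \<open>The Weierstrass M-test applies on each bounded interval of parameters. Continuity along
  real multiples of one fixed matrix suffices, because every series below is evaluated at such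
  multiples.\<close>

lemma continuous_on_matrix_series:
  fixes A :: "complex^'k^'k"
  assumes "\<And>K. summable (\<lambda>n. \<bar>c n\<bar> * K ^ n)"
  shows "continuous_on UNIV (\<lambda>x::real. \<Sum>n. c n *\<^sub>R matrix_power (x *\<^sub>R A) n)"
proof -
  obtain C K where "C \<ge> 0" "K \<ge> 0" and CK: "\<And>n. norm (matrix_power A n) \<le> C * K ^ n"
    using norm_matrix_power_le by blast
  have cont: "continuous_on {-r<..<r} (\<lambda>x::real. \<Sum>n. c n *\<^sub>R matrix_power (x *\<^sub>R A) n)" for r
  proof (rule uniform_limit_theorem)
    have bound: "norm (c n *\<^sub>R matrix_power (x *\<^sub>R A) n) \<le> C * (\<bar>c n\<bar> * (r * K) ^ n)"
      if "x \<in> {-r<..<r}" for n x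
    proof -
      have "\<bar>x\<bar> ^ n * norm (matrix_power A n) \<le> r ^ n * (C * K ^ n)"
        using that CK \<open>C \<ge> 0\<close> \<open>K \<ge> 0\<close> by (intro mult_mono power_mono) auto
      then have "\<bar>c n\<bar> * (\<bar>x\<bar> ^ n * norm (matrix_power A n)) \<le> \<bar>c n\<bar> * (r ^ n * (C * K ^ n))"
        by (rule mult_left_mono) simp
      then show ?thesis
        by (simp add: matrix_power_scaleR power_abs abs_mult power_mult_distrib mult_ac)
    qed
    show "uniform_limit {-r<..<r} (\<lambda>n x. \<Sum>i<n. c i *\<^sub>R matrix_power (x *\<^sub>R A) i)
        (\<lambda>x. \<Sum>n. c n *\<^sub>R matrix_power (x *\<^sub>R A) n) sequentially"
      by (rule Weierstrass_m_test[OF bound]) (use assms in \<open>auto intro: summable_mult\<close>)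
    show "\<forall>\<^sub>F n in sequentially.
        continuous_on {-r<..<r} (\<lambda>x. \<Sum>i<n. c i *\<^sub>R matrix_power (x *\<^sub>R A) i)"
      unfolding matrix_power_scaleR by (intro always_eventually allI continuous_intros)
  qed simp
  have "isCont (\<lambda>x::real. \<Sum>n. c n *\<^sub>R matrix_power (x *\<^sub>R A) n) x" for x
    using cont[of "\<bar>x\<bar> + 1"]
    by (rule continuous_on_interior) (auto simp: interior_open)
  then show ?thesis
    by (simp add: continuous_on_eq_continuous_at)
qed

section \<open>Growth of the Gamma function and convergence of the Mittag-Leffler series\<close>

text \<open>In the Gamma integral the part with \<open>t < M\<close> is dropped and
  \<open>t powr (x - 1)\<close> is bounded below by its value at \<open>M\<close>; the tail of
  \<open>exp (- t)\<close> integrates to \<open>exp (- M)\<close>.\<close>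

lemma Gamma_ge_powr:
  assumes "x \<ge> 1" "M > 0"
  shows "M powr (x - 1) * exp (- M) \<le> Gamma (x :: real)"
proof (rule has_integral_le)
  show "((\<lambda>t. if t \<in> {M..} then M powr (x - 1) * exp (- 1 * t) else 0)
      has_integral M powr (x - 1) * exp (- M)) {0..}"
    using has_integral_mult_right[OF has_integral_exp_minus_to_infinity[of 1 M]] assms
    by (subst has_integral_restrict) auto
  show "((\<lambda>t. t powr (x - 1) / exp t) has_integral Gamma x) {0..}"
    using assms by (intro Gamma_integral_real) auto
  show "(if t \<in> {M..} then M powr (x - 1) * exp (- 1 * t) else 0) \<le> t powr (x - 1) / exp t" for t
    using assms by (auto simp: exp_minus field_simps intro!: powr_mono2)
qed

lemma summable_inverse_Gamma:
  fixes \<phi> \<psi> K :: real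
  assumes "\<phi> > 0" "\<psi> > 0"
  shows "summable (\<lambda>n. \<bar>1 / Gamma (\<phi> * real n + \<psi>)\<bar> * K ^ n)"
proof -
  \<comment> \<open>Chosen so that \<open>M powr \<phi>\<close> is
    \<open>2 * (\<bar>K\<bar> + 1)\<close>: the Gamma values then outgrow the powers of
    \<open>K\<close> by a factor of at least \<open>2 ^ n\<close>, up to a constant. Adding 1 keeps
    the base positive when \<open>K = 0\<close>.\<close>
  define M where "M = (2 * (\<bar>K\<bar> + 1)) powr (1 / \<phi>)"
  have "M > 0" by (simp add: M_def add_pos_nonneg)
  have M: "M powr (\<phi> * real n) = (2 * (\<bar>K\<bar> + 1)) ^ n" for n
  proof -
    have "M powr (\<phi> * real n) = (2 * (\<bar>K\<bar> + 1)) powr real n"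
      using \<open>\<phi> > 0\<close> by (simp add: M_def powr_powr)
    also have "\<dots> = (2 * (\<bar>K\<bar> + 1)) ^ n"
      by (intro powr_realpow) (simp add: add_pos_nonneg)
    finally show ?thesis .
  qed
  define C where "C = M powr (\<psi> - 1) * exp (- M)"
  have "C > 0" using \<open>M > 0\<close> by (simp add: C_def)
  \<comment> \<open>From this index on the argument of Gamma is at least 1, as the lower bound
    requires.\<close>
  have "\<forall>\<^sub>F n in sequentially. 1 / \<phi> \<le> real n"
    by (rule eventually_at_top_linorderI[of "nat \<lceil>1 / \<phi>\<rceil>"]) linarith
  then have "\<forall>\<^sub>F n in sequentially.
      norm (\<bar>1 / Gamma (\<phi> * real n + \<psi>)\<bar> * K ^ n) \<le> (1 / C) * (1 / 2) ^ n"
  proof eventually_elim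
    case (elim n)
    then have "\<phi> * real n + \<psi> \<ge> 1"
      using assms by (simp add: field_simps)
    then have "M powr (\<phi> * real n + \<psi> - 1) * exp (- M) \<le> Gamma (\<phi> * real n + \<psi>)"
      using \<open>M > 0\<close> by (rule Gamma_ge_powr)
    moreover have "M powr (\<phi> * real n + \<psi> - 1) = M powr (\<phi> * real n) * M powr (\<psi> - 1)"
      by (simp flip: powr_add add: algebra_simps)
    ultimately have G: "(2 * (\<bar>K\<bar> + 1)) ^ n * C \<le> Gamma (\<phi> * real n + \<psi>)"
      by (simp add: C_def M mult_ac)
    have "\<bar>K\<bar> ^ n / Gamma (\<phi> * real n + \<psi>) \<le> (\<bar>K\<bar> + 1) ^ n / ((2 * (\<bar>K\<bar> + 1)) ^ n * C)"
      using G \<open>C > 0\<close> by (intro frac_le power_mono) (auto simp: add_pos_nonneg)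
    also have "\<dots> = (1 / C) * (1 / 2) ^ n"
      unfolding power_mult_distrib by (simp add: power_divide add_nonneg_pos less_imp_neq[symmetric])
    finally show ?case
      using assms by (simp add: abs_mult power_abs Gamma_real_nonneg add_nonneg_pos)
  qed
  then show ?thesis
    by (rule summable_comparison_test_ev) (intro summable_mult summable_geometric, simp)
qed

lemma continuous_on_mittag_leffler:
  assumes "\<phi> > 0" "\<psi> > 0" "continuous_on X g"
  shows "continuous_on X (\<lambda>x. mittag_leffler \<phi> \<psi> (g x *\<^sub>R A))"
  unfolding mittag_leffler_def
  by (rule continuous_on_compose2[OF continuous_on_matrix_series[OF summable_inverse_Gamma] assms(3)])
    (use assms in auto)

lemma summable_exp_coeff: "summable (\<lambda>n. \<bar>1 / fact n\<bar> * (K::real) ^ n)"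
  using summable_exp[of K] by (simp add: divide_inverse)

lemma continuous_on_matrix_powr:
  assumes "continuous_on X g" "\<And>x. x \<in> X \<Longrightarrow> g x > 0"
  shows "continuous_on X (\<lambda>x. matrix_powr (g x) A)"
proof -
  have "continuous_on X (\<lambda>x. ln (g x))"
    using assms by (intro continuous_on_ln) force+
  then show ?thesis
    unfolding matrix_powr_def matrix_exp_def
    by (rule continuous_on_compose2[OF continuous_on_matrix_series[OF summable_exp_coeff]]) simp
qed

section \<open>The matrix exponential on commuting matrices\<close>

lemma matrix_exp_sums: "(\<lambda>n. (1 / fact n) *\<^sub>R matrix_power A n) sums matrix_exp A"
  unfolding matrix_exp_def
  by (rule summable_sums[OF summable_norm_cancel[OF summable_norm_matrix_series[OF summable_exp_coeff]]])

lemma matrix_exp_scaleR_mat_1: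
  "matrix_exp (c *\<^sub>R mat 1) = exp c *\<^sub>R (mat 1 :: complex^'k^'k)"
proof -
  have "(\<lambda>n. (c ^ n /\<^sub>R fact n) *\<^sub>R (mat 1 :: complex^'k^'k)) sums (exp c *\<^sub>R mat 1)"
    by (intro sums_scaleR_left exp_converges)
  then show ?thesis
    using matrix_exp_sums[of "c *\<^sub>R mat 1 :: complex^'k^'k"]
    by (simp add: matrix_power_scaleR matrix_power_mat_1 divide_inverse mult_ac sums_unique2)
qed

text \<open>This is the binomial theorem divided by \<open>n!\<close>. In the induction, multiplying
  by \<open>A + B\<close> raises one of the two indices; the resulting weights \<open>i\<close> and
  \<open>Suc n - i\<close> add up to \<open>Suc n\<close>, which cancels.\<close>

lemma matrix_exp_series_add_commuting:
  fixes A B :: "complex^'k^'k"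
  defines T_def: "T \<equiv> \<lambda>A n. (1 / fact n) *\<^sub>R matrix_power A n"
  assumes comm: "A ** B = B ** A"
  shows "T (A + B) n = (\<Sum>i\<le>n. T A i ** T B (n - i))"
proof (induction n)
  case 0
  show ?case
    unfolding T_def by simp
next
  case (Suc n)
  have times_T: "A ** T A n = real (Suc n) *\<^sub>R T A (Suc n)" for A :: "complex^'k^'k" and n
    by (simp add: T_def matrix_mult_scaleR_right del: of_nat_Suc)
  have pow_comm: "B ** matrix_power A n = matrix_power A n ** B" for n
    by (induction n) (simp_all, metis comm matrix_mul_assoc)
  then have T_comm: "B ** T A n = T A n ** B" for n
    by (simp add: T_def matrix_mult_scaleR_left matrix_mult_scaleR_right)
  have "real (Suc n) *\<^sub>R T (A + B) (Suc n) = (A + B) ** (\<Sum>i\<le>n. T A i ** T B (n - i))"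
    by (metis Suc.IH times_T)
  also have "\<dots> = (\<Sum>i\<le>n. (A ** T A i) ** T B (n - i)) + (\<Sum>i\<le>n. T A i ** (B ** T B (n - i)))"
    by (simp add: matrix_add_rdistrib matrix_mult.sum_right matrix_mul_assoc T_comm sum.distrib)
  also have "\<dots> = (\<Sum>i\<le>n. real (Suc i) *\<^sub>R (T A (Suc i) ** T B (n - i)))
                + (\<Sum>i\<le>n. real (Suc n - i) *\<^sub>R (T A i ** T B (Suc n - i)))"
    by (simp add: times_T Suc_diff_le matrix_mult_scaleR_left matrix_mult_scaleR_right
        del: of_nat_Suc)
  \<comment> \<open>Both sums are brought to the range up to \<open>Suc n\<close>: the new term at
    \<open>i = 0\<close> here, and the one at \<open>i = Suc n\<close> in the next sum, have
    coefficient 0.\<close>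
  also have "(\<Sum>i\<le>n. real (Suc i) *\<^sub>R (T A (Suc i) ** T B (n - i)))
           = (\<Sum>i\<le>Suc n. real i *\<^sub>R (T A i ** T B (Suc n - i)))"
    by (subst sum.atMost_Suc_shift) simp
  also have "(\<Sum>i\<le>n. real (Suc n - i) *\<^sub>R (T A i ** T B (Suc n - i)))
           = (\<Sum>i\<le>Suc n. real (Suc n - i) *\<^sub>R (T A i ** T B (Suc n - i)))"
    by simp
  also have "(\<Sum>i\<le>Suc n. real i *\<^sub>R (T A i ** T B (Suc n - i)))
           + (\<Sum>i\<le>Suc n. real (Suc n - i) *\<^sub>R (T A i ** T B (Suc n - i)))
           = real (Suc n) *\<^sub>R (\<Sum>i\<le>Suc n. T A i ** T B (Suc n - i))"
    by (simp only: scaleR_right.sum flip: sum.distrib scaleR_add_left of_nat_add) simp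
  finally show ?case
    by (simp del: sum.cl_ivl_Suc)
qed

text \<open>Each entry of the product is a finite sum of products of two absolutely convergent
  complex series. Their Cauchy products, summed over the inner index \<open>l\<close>, are the
  entries of the convolution in the preceding lemma.\<close>

lemma matrix_exp_add_commuting:
  fixes A B :: "complex^'k^'k"
  assumes comm: "A ** B = B ** A"
  shows "matrix_exp (A + B) = matrix_exp A ** matrix_exp B"
proof -
  define T where "T A n = (1 / fact n) *\<^sub>R matrix_power A n" for A :: "complex^'k^'k" and n
  have entry: "(\<lambda>n. T A n $ i $ j) sums (matrix_exp A $ i $ j)" for A :: "complex^'k^'k" and i j
    using matrix_exp_sums[of A] unfolding T_def
    by (intro bounded_linear.sums[OF bounded_linear_vec_nth])
  have norm_entry: "summable (\<lambda>n. norm (T A n $ i $ j))" for A :: "complex^'k^'k" and i j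
  proof (rule summable_comparison_test')
    show "summable (\<lambda>n. norm (T A n))"
      unfolding T_def by (intro summable_norm_matrix_series summable_exp_coeff)
    have "norm (T A n $ i $ j) \<le> norm (T A n)" for n
      by (rule order_trans[OF Finite_Cartesian_Product.norm_nth_le Finite_Cartesian_Product.norm_nth_le])
    then show "norm (norm (T A n $ i $ j)) \<le> norm (T A n)" if "n \<ge> 0" for n
      by simp
  qed
  have "matrix_exp (A + B) $ i $ j = (matrix_exp A ** matrix_exp B) $ i $ j" for i j
  proof (rule sums_unique2[OF entry])
    have "(\<lambda>n. \<Sum>l\<in>UNIV. \<Sum>m\<le>n. T A m $ i $ l * T B (n - m) $ l $ j) sums
        (\<Sum>l\<in>UNIV. (\<Sum>n. T A n $ i $ l) * (\<Sum>n. T B n $ l $ j))"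
      by (intro sums_sum Cauchy_product_sums norm_entry)
    also have "(\<Sum>l\<in>UNIV. (\<Sum>n. T A n $ i $ l) * (\<Sum>n. T B n $ l $ j)) =
        (matrix_exp A ** matrix_exp B) $ i $ j"
      by (simp add: matrix_matrix_mult_def sums_unique[OF entry, symmetric])
    also have "(\<lambda>n. \<Sum>l\<in>UNIV. \<Sum>m\<le>n. T A m $ i $ l * T B (n - m) $ l $ j) =
        (\<lambda>n. T (A + B) n $ i $ j)"
      unfolding T_def matrix_exp_series_add_commuting[OF comm]
      by (subst sum.swap) (simp add: matrix_matrix_mult_def sum_component)
    finally show "(\<lambda>n. T (A + B) n $ i $ j) sums (matrix_exp A ** matrix_exp B) $ i $ j" .
  qed
  then show ?thesis
    by (simp add: vec_eq_iff)
qed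

section \<open>Power laws for positive reals raised to matrices\<close>

lemma matrix_powr_commute:
  assumes "A ** B = B ** A"
  shows "matrix_powr x A ** matrix_powr y B = matrix_powr y B ** matrix_powr x A"
  using matrix_exp_add_commuting[of "ln x *\<^sub>R A" "ln y *\<^sub>R B"]
    matrix_exp_add_commuting[of "ln y *\<^sub>R B" "ln x *\<^sub>R A"] assms
  by (simp add: matrix_powr_def matrix_mult_scaleR_left matrix_mult_scaleR_right add.commute mult.commute)

lemma matrix_powr_add:
  assumes "A ** B = B ** A"
  shows "matrix_powr x (A + B) = matrix_powr x A ** matrix_powr x B"
  using assms unfolding matrix_powr_def scaleR_add_right
  by (intro matrix_exp_add_commuting) (simp add: matrix_mult_scaleR_left matrix_mult_scaleR_right)

lemma matrix_powr_mult:
  assumes "x > 0" "y > 0"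
  shows "matrix_powr (x * y) A = matrix_powr x A ** matrix_powr y A"
  using assms unfolding matrix_powr_def ln_mult_pos[OF assms] scaleR_add_left
  by (intro matrix_exp_add_commuting)
    (simp add: matrix_mult_scaleR_left matrix_mult_scaleR_right mult.commute)

lemma matrix_powr_mat_1: "x > 0 \<Longrightarrow> matrix_powr x (mat 1) = x *\<^sub>R mat 1"
  by (simp add: matrix_powr_def matrix_exp_scaleR_mat_1)

lemma matrix_powr_1_left: "matrix_powr 1 A = mat 1"
  using matrix_exp_scaleR_mat_1[of 0] by (simp add: matrix_powr_def)

lemma matrix_powr_minus_mat_1:
  assumes "x > 0"
  shows "x *\<^sub>R matrix_powr x (A - mat 1) = matrix_powr x A"
  using matrix_powr_add[of "A - mat 1" "mat 1" x] assms
  by (simp add: matrix_powr_mat_1 matrix_mult_scaleR_right)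

text \<open>Each missing identity in the exponents costs one factor \<open>x\<close>. Merging the
  two powers into one is where commutativity of \<open>P\<close> and \<open>Q\<close>
  enters.\<close>

lemma matrix_powr_minus_mat_1_mult:
  assumes "x > 0" "P ** Q = Q ** P"
  shows "x\<^sup>2 *\<^sub>R (matrix_powr x (P - mat 1) ** matrix_powr x (Q - mat 1)) = matrix_powr x (P + Q)"
  by (simp add: matrix_powr_add[OF assms(2)] matrix_powr_minus_mat_1[OF assms(1), of P, symmetric]
      matrix_powr_minus_mat_1[OF assms(1), of Q, symmetric]
      matrix_mult_scaleR_left matrix_mult_scaleR_right power2_eq_square)

lemma matrix_powr_square:
  assumes "x > 0"
  shows "matrix_powr (x\<^sup>2) A = matrix_powr x (2 *\<^sub>R A)"
  using assms by (simp add: matrix_powr_def ln_realpow mult.commute)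

lemma matrix_inv_matrix_powr:
  assumes "x > 0"
  shows "matrix_inv (matrix_powr x A) = matrix_powr (1 / x) A"
proof -
  have inv: "matrix_powr x A ** matrix_powr (1 / x) A = mat 1"
    "matrix_powr (1 / x) A ** matrix_powr x A = mat 1"
    using assms matrix_powr_mult[of x "1 / x" A] matrix_powr_mult[of "1 / x" x A]
    by (simp_all add: matrix_powr_1_left)
  show ?thesis
    \<comment> \<open>\<open>matrix_inv\<close> is a choice among two-sided inverses, so uniqueness
      of the inverse has to be supplied.\<close>
    unfolding matrix_inv_def
  proof (rule some_equality)
    fix B
    assume "matrix_powr x A ** B = mat 1 \<and> B ** matrix_powr x A = mat 1"
    then show "B = matrix_powr (1 / x) A"
      by (metis inv(2) matrix_mul_assoc matrix_mul_lid matrix_mul_rid)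
  qed (use inv in simp)
qed

text \<open>The left inverse \<open>E\<close> carries integrability back from
  \<open>D ** f x\<close> to \<open>f\<close>. Thus the constant can be pulled out even when no
  integral exists, both sides then being 0.\<close>

lemma integral_matrix_mult_left:
  fixes D E :: "complex^'k^'k" and f :: "real \<Rightarrow> complex^'k^'k"
  assumes "E ** D = mat 1"
  shows "(\<lambda>x. D ** f x) integrable_on S \<longleftrightarrow> f integrable_on S"
    and "integral S (\<lambda>x. D ** f x) = D ** integral S f"
proof -
  have lin: "bounded_linear ((**) D :: complex^'k^'k \<Rightarrow> complex^'k^'k)" for D
    by (rule matrix_mult.bounded_linear_right)
  show iff: "(\<lambda>x. D ** f x) integrable_on S \<longleftrightarrow> f integrable_on S"
  proof
    assume "(\<lambda>x. D ** f x) integrable_on S"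
    from integrable_linear[OF this lin[of E]] show "f integrable_on S"
      by (simp add: o_def matrix_mul_assoc assms)
  qed (use integrable_linear[OF _ lin[of D]] in \<open>auto simp: o_def\<close>)
  show "integral S (\<lambda>x. D ** f x) = D ** integral S f"
  proof (cases "f integrable_on S")
    case True
    from integral_linear[OF this lin[of D]] show ?thesis by (simp add: o_def)
  next
    case False
    then show ?thesis
      using iff by (simp add: not_integrable_integral matrix_mult.zero_right)
  qed
qed

section \<open>The three substitutions\<close>

lemma continuous_on_beta_log_integrand:
  assumes "\<phi> > 0" "\<psi> > 0" "a > 0" "b > 0"
  shows "continuous_on {0<..<1} (beta_log_integrand \<phi> \<psi> R S \<eta> \<xi> a b P Q)"
proof -
  \<comment> \<open>The Mittag-Leffler arguments are put in the form of a continuous real factor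
    times a fixed matrix.\<close>
  have "beta_log_integrand \<phi> \<psi> R S \<eta> \<xi> a b P Q = (\<lambda>x. (a powr (1 - x) * b powr x) *\<^sub>R
       (matrix_powr x (P - mat 1) ** matrix_powr (1 - x) (Q - mat 1)
        ** mittag_leffler \<phi> \<psi> ((- inverse (x powr \<eta>)) *\<^sub>R R)
        ** mittag_leffler \<phi> \<psi> ((- inverse ((1 - x) powr \<xi>)) *\<^sub>R S)))"
    by (simp add: fun_eq_iff beta_log_integrand_def)
  then show ?thesis
    using assms
    by (simp only:) (intro continuous_on_scaleR matrix_mult.continuous_on continuous_on_matrix_powr
        continuous_on_mittag_leffler continuous_intros; force)
qed

text \<open>For \<open>s = sin \<theta>\<close> and \<open>c = cos \<theta>\<close> the factor
  \<open>2 * s * c\<close> is the derivative of the substitution. One \<open>s\<close> and one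
  \<open>c\<close> are absorbed into the matrix powers, turning the exponents \<open>2P - 2I\<close>
  and \<open>2Q - 2I\<close> into \<open>2P - I\<close> and \<open>2Q - I\<close>, while the matrix
  factors keep their order.\<close>

lemma beta_log_integrand_square:
  assumes "a > 0" "b > 0" "s > 0" "c > 0" and sc: "s\<^sup>2 + c\<^sup>2 = 1"
  shows "(2 * s * c) *\<^sub>R beta_log_integrand \<phi> \<psi> R S \<eta> \<xi> a b P Q (s\<^sup>2) =
    (2 * a) *\<^sub>R (((b / a) powr s\<^sup>2) *\<^sub>R
      (matrix_powr s (2 *\<^sub>R P - mat 1) ** matrix_powr c (2 *\<^sub>R Q - mat 1)
       ** mittag_leffler \<phi> \<psi> (- (((1 / s) powr (2 * \<eta>)) *\<^sub>R R))
       ** mittag_leffler \<phi> \<psi> (- (((1 / c) powr (2 * \<xi>)) *\<^sub>R S))))"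
proof -
  have c: "1 - s\<^sup>2 = c\<^sup>2"
    using sc by simp
  have scalar: "a powr c\<^sup>2 * b powr s\<^sup>2 = a * (b / a) powr s\<^sup>2"
    using assms(1,2) by (simp add: powr_divide powr_diff flip: c)
  have M: "matrix_powr x (2 *\<^sub>R A - mat 1) = x *\<^sub>R matrix_powr (x\<^sup>2) (A - mat 1)"
    if "x > 0" for x and A :: "complex^'a^'a"
    using matrix_powr_minus_mat_1[OF that, of "2 *\<^sub>R A - mat 1"] matrix_powr_square[OF that, of "A - mat 1"]
    by (simp add: scaleR_diff_right scaleR_2 algebra_simps)
  have "inverse ((x\<^sup>2) powr e) = (1 / x) powr (2 * e)" if "x > 0" for x e :: real
  proof -
    have "(x\<^sup>2) powr e = x powr (2 * e)"
      using that by (simp add: powr_powr flip: powr_numeral)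
    then show ?thesis
      using that by (simp add: powr_divide inverse_eq_divide)
  qed
  with assms(3,4) show ?thesis
    by (simp add: beta_log_integrand_def c scalar M matrix_mult_scaleR_left matrix_mult_scaleR_right
        mult_ac)
qed

text \<open>Splitting \<open>t / (1 + t)\<close> leaves the two powers of \<open>1 / (1 + t)\<close>
  next to each other; together with the derivative \<open>1 / (1 + t)\<^sup>2\<close> they merge
  into the inverse of \<open>matrix_powr (1 + t) (P + Q)\<close>.\<close>

lemma beta_log_integrand_halfline:
  assumes "t > 0" and comm: "P ** Q = Q ** P"
  shows "(1 / (1 + t)\<^sup>2) *\<^sub>R beta_log_integrand \<phi> \<psi> R S \<eta> \<xi> a b P Q (t / (1 + t)) =
    (a powr (1 / (1 + t)) * b powr (t / (1 + t))) *\<^sub>R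
      (matrix_divide (matrix_powr t (P - mat 1)) (matrix_powr (1 + t) (P + Q))
       ** mittag_leffler \<phi> \<psi> (- (((1 + 1 / t) powr \<eta>) *\<^sub>R R))
       ** mittag_leffler \<phi> \<psi> (- (((1 + t) powr \<xi>) *\<^sub>R S)))"
proof -
  have eq: "1 - t / (1 + t) = 1 / (1 + t)" "1 + 1 / t = (1 + t) / t"
    using \<open>t > 0\<close> by (auto simp: field_simps)
  have "matrix_powr (t / (1 + t)) (P - mat 1) =
      matrix_powr t (P - mat 1) ** matrix_powr (1 / (1 + t)) (P - mat 1)"
    using matrix_powr_mult[of t "1 / (1 + t)"] \<open>t > 0\<close> by simp
  moreover have "matrix_inv (matrix_powr (1 + t) (P + Q)) = (1 / (1 + t)\<^sup>2) *\<^sub>R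
      (matrix_powr (1 / (1 + t)) (P - mat 1) ** matrix_powr (1 / (1 + t)) (Q - mat 1))"
    using matrix_inv_matrix_powr[of "1 + t"] matrix_powr_minus_mat_1_mult[OF _ comm, of "1 / (1 + t)"]
      \<open>t > 0\<close> by (simp add: power_divide)
  moreover have "inverse ((t / (1 + t)) powr \<eta>) = ((1 + t) / t) powr \<eta>"
    "inverse ((1 / (1 + t)) powr \<xi>) = (1 + t) powr \<xi>"
    using \<open>t > 0\<close> by (simp_all add: powr_divide)
  ultimately show ?thesis
    by (simp add: beta_log_integrand_def matrix_divide_def eq matrix_mult_scaleR_left
        matrix_mult_scaleR_right matrix_mul_assoc mult_ac)
qed

lemma matrix_divide_powr_2:
  "matrix_divide (c *\<^sub>R matrix_powr 2 (mat 1)) (matrix_powr 2 A) = (2 * c) *\<^sub>R matrix_powr (1/2) A"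
  by (simp add: matrix_divide_def matrix_inv_matrix_powr matrix_powr_mat_1 matrix_mult_scaleR_left mult.commute)

text \<open>The halves in \<open>(1 + t) / 2\<close> and \<open>(1 - t) / 2\<close> are split off
  and collected on the left as a power of \<open>1/2\<close> with exponent \<open>P + Q\<close>.
  This yields a factor 4, which the derivative \<open>1 / 2\<close> reduces to the 2 coming from
  \<open>matrix_powr 2 (mat 1)\<close>.\<close>

lemma beta_log_integrand_symmetric:
  assumes "a > 0" "b > 0" "-1 < t" "t < 1" and comm: "P ** Q = Q ** P"
  shows "(1 / 2) *\<^sub>R beta_log_integrand \<phi> \<psi> R S \<eta> \<xi> a b P Q ((1 + t) / 2) =
    matrix_divide (sqrt (a * b) *\<^sub>R matrix_powr 2 (mat 1)) (matrix_powr 2 (P + Q)) **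
    (((b / a) powr (t / 2)) *\<^sub>R
      (matrix_powr (1 + t) (P - mat 1) ** matrix_powr (1 - t) (Q - mat 1)
       ** mittag_leffler \<phi> \<psi> (- ((((1 + t) / 2) powr (- \<eta>)) *\<^sub>R R))
       ** mittag_leffler \<phi> \<psi> (- ((((1 - t) / 2) powr (- \<xi>)) *\<^sub>R S))))"
proof -
  have eq: "1 - (1 + t) / 2 = (1 - t) / 2"
    by (simp add: field_simps)
  have "a powr ((1 - t) / 2) * b powr ((1 + t) / 2) =
      (a powr (1/2) / a powr (t/2)) * (b powr (1/2) * b powr (t/2))"
    using assms(1,2) by (simp add: diff_divide_distrib add_divide_distrib powr_add powr_diff)
  also have "\<dots> = sqrt (a * b) * (b / a) powr (t / 2)"
    using assms(1,2) by (simp add: powr_divide powr_half_sqrt real_sqrt_mult)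
  finally have scalar: "a powr ((1 - t) / 2) * b powr ((1 + t) / 2) = sqrt (a * b) * (b / a) powr (t / 2)" .
  have split: "matrix_powr ((1 + t) / 2) (P - mat 1) = matrix_powr (1/2) (P - mat 1) ** matrix_powr (1 + t) (P - mat 1)"
    "matrix_powr ((1 - t) / 2) (Q - mat 1) = matrix_powr (1/2) (Q - mat 1) ** matrix_powr (1 - t) (Q - mat 1)"
    using matrix_powr_mult[of "1/2" "1 + t"] matrix_powr_mult[of "1/2" "1 - t"] assms(3,4) by auto
  have "(P - mat 1) ** (Q - mat 1) = (Q - mat 1) ** (P - mat 1)"
    by (simp add: matrix_mult.diff_left matrix_mult.diff_right comm)
  \<comment> \<open>The constant power belonging to \<open>Q\<close> stands to the right of a power
    depending on \<open>t\<close>; it must pass that power to reach the constant prefactor.\<close>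
  then have swap: "matrix_powr (1 + t) (P - mat 1) ** matrix_powr (1/2) (Q - mat 1) =
      matrix_powr (1/2) (Q - mat 1) ** matrix_powr (1 + t) (P - mat 1)"
    by (rule matrix_powr_commute)
  have half: "matrix_powr (1/2) (P + Q) =
      (1/4) *\<^sub>R (matrix_powr (1/2) (P - mat 1) ** matrix_powr (1/2) (Q - mat 1))"
    using matrix_powr_minus_mat_1_mult[OF _ comm, of "1/2"] by (simp add: power2_eq_square)
  have "matrix_powr ((1 + t) / 2) (P - mat 1) ** matrix_powr ((1 - t) / 2) (Q - mat 1) =
      matrix_powr (1/2) (P - mat 1) ** (matrix_powr (1 + t) (P - mat 1)
        ** matrix_powr (1/2) (Q - mat 1)) ** matrix_powr (1 - t) (Q - mat 1)"
    unfolding split by (simp add: matrix_mul_assoc)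
  also have "\<dots> = 4 *\<^sub>R (matrix_powr (1/2) (P + Q) **
      (matrix_powr (1 + t) (P - mat 1) ** matrix_powr (1 - t) (Q - mat 1)))"
    unfolding swap half by (simp add: matrix_mul_assoc matrix_mult_scaleR_left)
  finally have prod: "matrix_powr ((1 + t) / 2) (P - mat 1) ** matrix_powr ((1 - t) / 2) (Q - mat 1) =
    4 *\<^sub>R (matrix_powr (1/2) (P + Q) **
      (matrix_powr (1 + t) (P - mat 1) ** matrix_powr (1 - t) (Q - mat 1)))" .
  show ?thesis
    unfolding beta_log_integrand_def eq scalar prod matrix_divide_powr_2 powr_minus
    by (simp add: matrix_mult_scaleR_left matrix_mult_scaleR_right matrix_mul_assoc)
qed

text \<open>Each formula is paired with an equivalence of integrability, so that its equality is not
  merely one between default values. Formulas (ii) and (iii) are stated for commuting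
  \<open>P\<close> and \<open>Q\<close>, because they combine powers with exponents in
  \<open>P\<close> and in \<open>Q\<close> into one with exponent \<open>P + Q\<close>.\<close>

theorem theorem3p5:
  fixes \<phi> \<psi> a b \<eta> \<xi> :: real
    and P Q R S :: "complex^'k^'k"
  assumes "\<phi> > 0" and "\<psi> > 0" and "a > 0" and "b > 0" and "\<eta> > 0" and "\<xi> > 0"
    and "P \<in> herm_pos_stable" and "Q \<in> herm_pos_stable"
    and "R \<in> herm_pos_stable" and "S \<in> herm_pos_stable"
  shows
    "let f = beta_log_integrand \<phi> \<psi> R S \<eta> \<xi> a b P Q;
         BL = beta_log \<phi> \<psi> R S \<eta> \<xi> a b P Q;
         g1 = (\<lambda>\<theta>. ((b / a) powr ((sin \<theta>)\<^sup>2)) *\<^sub>R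
                (matrix_powr (sin \<theta>) (2 *\<^sub>R P - mat 1) ** matrix_powr (cos \<theta>) (2 *\<^sub>R Q - mat 1)
                 ** mittag_leffler \<phi> \<psi> (- (((1 / sin \<theta>) powr (2 * \<eta>)) *\<^sub>R R))
                 ** mittag_leffler \<phi> \<psi> (- (((1 / cos \<theta>) powr (2 * \<xi>)) *\<^sub>R S))));
         g2 = (\<lambda>t. (a powr (1 / (1 + t)) * b powr (t / (1 + t))) *\<^sub>R
                (matrix_divide (matrix_powr t (P - mat 1)) (matrix_powr (1 + t) (P + Q))
                 ** mittag_leffler \<phi> \<psi> (- (((1 + 1 / t) powr \<eta>) *\<^sub>R R))
                 ** mittag_leffler \<phi> \<psi> (- (((1 + t) powr \<xi>) *\<^sub>R S))));
         g3 = (\<lambda>t. ((b / a) powr (t / 2)) *\<^sub>R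
                (matrix_powr (1 + t) (P - mat 1) ** matrix_powr (1 - t) (Q - mat 1)
                 ** mittag_leffler \<phi> \<psi> (- ((((1 + t) / 2) powr (- \<eta>)) *\<^sub>R R))
                 ** mittag_leffler \<phi> \<psi> (- ((((1 - t) / 2) powr (- \<xi>)) *\<^sub>R S))))
     in (f integrable_on {0<..<1} \<longleftrightarrow> g1 integrable_on {0<..<pi / 2}) \<and>
        BL = (2 * a) *\<^sub>R integral {0<..<pi / 2} g1 \<and>
        (P ** Q = Q ** P \<longrightarrow>
          (f integrable_on {0<..<1} \<longleftrightarrow> g2 integrable_on {0<..}) \<and>
          BL = integral {0<..} g2) \<and>
        (P ** Q = Q ** P \<longrightarrow>
          (f integrable_on {0<..<1} \<longleftrightarrow> g3 integrable_on {-1<..<1}) \<and>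
          BL = matrix_divide (sqrt (a * b) *\<^sub>R matrix_powr 2 (mat 1)) (matrix_powr 2 (P + Q))
                 ** integral {-1<..<1} g3)"
proof -
  define f where "f = beta_log_integrand \<phi> \<psi> R S \<eta> \<xi> a b P Q"
  define g1 where "g1 = (\<lambda>\<theta>. ((b / a) powr ((sin \<theta>)\<^sup>2)) *\<^sub>R
                (matrix_powr (sin \<theta>) (2 *\<^sub>R P - mat 1) ** matrix_powr (cos \<theta>) (2 *\<^sub>R Q - mat 1)
                 ** mittag_leffler \<phi> \<psi> (- (((1 / sin \<theta>) powr (2 * \<eta>)) *\<^sub>R R))
                 ** mittag_leffler \<phi> \<psi> (- (((1 / cos \<theta>) powr (2 * \<xi>)) *\<^sub>R S))))"
  define g2 where "g2 = (\<lambda>t. (a powr (1 / (1 + t)) * b powr (t / (1 + t))) *\<^sub>R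
                (matrix_divide (matrix_powr t (P - mat 1)) (matrix_powr (1 + t) (P + Q))
                 ** mittag_leffler \<phi> \<psi> (- (((1 + 1 / t) powr \<eta>) *\<^sub>R R))
                 ** mittag_leffler \<phi> \<psi> (- (((1 + t) powr \<xi>) *\<^sub>R S))))"
  define g3 where "g3 = (\<lambda>t. ((b / a) powr (t / 2)) *\<^sub>R
                (matrix_powr (1 + t) (P - mat 1) ** matrix_powr (1 - t) (Q - mat 1)
                 ** mittag_leffler \<phi> \<psi> (- ((((1 + t) / 2) powr (- \<eta>)) *\<^sub>R R))
                 ** mittag_leffler \<phi> \<psi> (- ((((1 - t) / 2) powr (- \<xi>)) *\<^sub>R S))))"
  define D where "D = matrix_divide (sqrt (a * b) *\<^sub>R matrix_powr 2 (mat 1)) (matrix_powr 2 (P + Q))"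
  have cont: "continuous_on {0<..<1} f"
    unfolding f_def using assms by (intro continuous_on_beta_log_integrand)
  \<comment> \<open>The scalar stays under the integral for the substitution and is extracted at the
    end, where \<open>a > 0\<close> keeps integrability equivalent.\<close>
  have "((\<lambda>\<theta>. (2 * a) *\<^sub>R g1 \<theta>) has_integral I) {0<..<pi / 2} \<longleftrightarrow> (f has_integral I) {0<..<1}" for I
  proof -
    have "((\<lambda>\<theta>. (2 * a) *\<^sub>R g1 \<theta>) has_integral I) {0<..<pi / 2} \<longleftrightarrow>
        ((\<lambda>\<theta>. (2 * sin \<theta> * cos \<theta>) *\<^sub>R f ((sin \<theta>)\<^sup>2)) has_integral I) {0<..<pi / 2}"
      unfolding f_def g1_def
      by (intro has_integral_cong beta_log_integrand_square[symmetric])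
        (use assms in \<open>auto intro: sin_gt_zero cos_gt_zero\<close>)
    also have "\<dots> \<longleftrightarrow> (f has_integral I) {0<..<1}"
    proof (rule has_integral_substitution_Ioo_Ioo[OF _ _ cont, where h = "\<lambda>x. arcsin (sqrt x)"])
      show "0 < (sin \<theta>)\<^sup>2 \<and> (sin \<theta>)\<^sup>2 < 1" if "0 < \<theta>" "\<theta> < pi / 2" for \<theta>
        using sin_gt_zero[of \<theta>] cos_gt_zero[of \<theta>] sin_cos_squared_add[of \<theta>] that
          zero_less_power[of "cos \<theta>" 2] zero_less_power[of "sin \<theta>" 2] by linarith
      show "(sin (arcsin (sqrt x)))\<^sup>2 = x" if "0 < x" "x < 1" for x :: real
        using that order_trans[of "-1" 0 "sqrt x"] by simp
    qed (auto intro!: derivative_eq_intros filterlim_sin_squared)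
    finally show ?thesis .
  qed
  note 1 = integral_eq_if_has_integral_iff[OF this]
  have 2: "(g2 integrable_on {0<..} \<longleftrightarrow> f integrable_on {0<..<1}) \<and> integral {0<..} g2 = integral {0<..<1} f"
    if comm: "P ** Q = Q ** P"
  proof (rule integral_eq_if_has_integral_iff)
    fix I
    have "(g2 has_integral I) {0<..} \<longleftrightarrow>
        ((\<lambda>t. (1 / (1 + t)\<^sup>2) *\<^sub>R f (t / (1 + t))) has_integral I) {0<..}"
      unfolding f_def g2_def
      by (intro has_integral_cong beta_log_integrand_halfline[symmetric] comm) simp
    also have "\<dots> \<longleftrightarrow> (f has_integral I) {0<..<1}"
    proof (rule has_integral_substitution_Ioi_Ioo[OF _ cont, where h = "\<lambda>x. x / (1 - x)"])
      show "((\<lambda>t. t / (1 + t)) has_real_derivative 1 / (1 + t)\<^sup>2) (at t)" if "0 < t" for t :: real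
        using that by (auto intro!: derivative_eq_intros simp: power2_eq_square)
    qed (rule filterlim_divide_one_plus | force simp: field_simps)+
    finally show "(g2 has_integral I) {0<..} \<longleftrightarrow> (f has_integral I) {0<..<1}" .
  qed
  have 3: "((\<lambda>t. D ** g3 t) integrable_on {-1<..<1} \<longleftrightarrow> f integrable_on {0<..<1}) \<and>
      integral {-1<..<1} (\<lambda>t. D ** g3 t) = integral {0<..<1} f"
    if comm: "P ** Q = Q ** P"
  proof (rule integral_eq_if_has_integral_iff)
    fix I
    have "((\<lambda>t. D ** g3 t) has_integral I) {-1<..<1} \<longleftrightarrow>
        ((\<lambda>t. (1 / 2) *\<^sub>R f ((1 + t) / 2)) has_integral I) {-1<..<1}"
      unfolding f_def g3_def D_def
      by (intro has_integral_cong beta_log_integrand_symmetric[symmetric] comm) (use assms in auto)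
    also have "\<dots> \<longleftrightarrow> (f has_integral I) {0<..<1}"
      by (rule has_integral_substitution_Ioo_Ioo[OF _ _ cont, where h = "\<lambda>x. 2 * x - 1"])
        (auto intro!: derivative_eq_intros filterlim_half_one_plus)
    finally show "((\<lambda>t. D ** g3 t) has_integral I) {-1<..<1} \<longleftrightarrow> (f has_integral I) {0<..<1}" .
  qed
  define c where "c = 2 * sqrt (a * b)"
  have "c > 0" using assms by (simp add: c_def)
  have D: "D = c *\<^sub>R matrix_powr (1 / 2) (P + Q)"
    by (simp add: D_def c_def matrix_divide_powr_2)
  \<comment> \<open>An explicit left inverse of the prefactor \<open>D\<close>, which allows
    \<open>D\<close> to be moved out of the third integral.\<close>
  have "((1 / c) *\<^sub>R matrix_powr 2 (P + Q)) ** D = mat 1"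
    using matrix_powr_mult[of 2 "1 / 2" "P + Q"] \<open>c > 0\<close>
    by (simp add: D matrix_mult_scaleR_left matrix_mult_scaleR_right matrix_powr_1_left)
  note D_cancel = integral_matrix_mult_left[OF this]
  have BL: "beta_log \<phi> \<psi> R S \<eta> \<xi> a b P Q = integral {0<..<1} f"
    by (simp add: beta_log_def f_def)
  show ?thesis
    unfolding Let_def BL
    unfolding f_def[symmetric] g1_def[symmetric] g2_def[symmetric] g3_def[symmetric] D_def[symmetric]
    using 1 2 3 assms(3) by (simp add: D_cancel)
qed

end
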